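(* Let $n\ge 4$ be an integer. There is no real constant $d(n)>(n-2)\pi$ depending only on $n$ with the following property: for every planar convex body $K\subset\mathbb{R}^2$ and any $n$ distinct points $x_1,\dots,x_n\in\mathrm{bd}K$ with $\sum_{i=1}^n \angle_K(x_i)\le d(n)$, at least one of $x_1,\dots,x_n$ is a diametral point of $K$.
   Context: A planar convex body is a compact convex subset of $\mathbb{R}^2$ with non-empty interior; $\mathrm{bd}K$ is its boundary. For $p\in\mathrm{bd}K$, the angle $\angle_K(p)\in(0,\pi]$ of $K$ at $p$ is the angular measure of the closure of $\{p+t(q-p): q\in K,\ t\ge 0\}$. A diameter of $K$ is a line-segment in $K$ whose length equals the maximal Euclidean distance between pairs of points of $K$. A diametral point of $K$ is an endpoint of some diameter of $K$. Any $n$ distinct points of $\mathrm{bd}K$ satisfy $\sum_{i=1}^n\angle_K(x_i)\ge (n-2)\pi$, with equality only if $K$ is the convex hull of these points, so constants $d(n)\le (n-2)\pi$ are regarded as trivial. *)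

theory Defs
  imports "HOL-Analysis.Analysis"
begin

definition planar_convex_body :: "(real^2) set \<Rightarrow> bool" where
  "planar_convex_body K \<longleftrightarrow> compact K \<and> convex K \<and> interior K \<noteq> {}"

definition support_cone :: "(real^2) set \<Rightarrow> real^2 \<Rightarrow> (real^2) set" where
  "support_cone K p = closure {p + t *\<^sub>R (q - p) | q t. q \<in> K \<and> 0 \<le> t}"

text \<open>The angular measure of a cone \<open>C\<close> with apex \<open>p\<close> is the arc length of its set of
  unit directions, i.e. the Lebesgue measure of that set parametrised over one full turn.\<close>

definition angular_measure :: "real^2 \<Rightarrow> (real^2) set \<Rightarrow> real" where
  "angular_measure p C =
     measure lborel {\<theta> \<in> {0..<2 * pi}. p + vector [cos \<theta>, sin \<theta>] \<in> C}"

definition body_angle :: "(real^2) set \<Rightarrow> real^2 \<Rightarrow> real" where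
  "body_angle K p = angular_measure p (support_cone K p)"

definition is_diameter :: "(real^2) set \<Rightarrow> real^2 \<Rightarrow> real^2 \<Rightarrow> bool" where
  "is_diameter K a b \<longleftrightarrow> closed_segment a b \<subseteq> K \<and> dist a b = diameter K"

definition diametral_point :: "(real^2) set \<Rightarrow> real^2 \<Rightarrow> bool" where
  "diametral_point K p \<longleftrightarrow> (\<exists>q. is_diameter K p q)"

end

theory Submission
  imports Defs
begin

text \<open>Take a flat rectangle with vertices \<open>(\<plusminus>1, \<plusminus>s)\<close> and glue to each short side a very
  obtuse triangle with apex \<open>(\<plusminus>(1 + s\<^sup>2), 0)\<close>. The distance \<open>2 (1 + s\<^sup>2)\<close> of the two apices
  exceeds every distance from a point of the two long sides, so no point of these sides is
  diametral; but the apices have angles close to \<open>pi\<close>, so the four vertices of the rectangle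
  have angle sum \<open>2 pi + 4 arctan s\<close>. Each further point on a long side contributes at
  most \<open>pi\<close>, and \<open>s\<close> is arbitrarily small.\<close>

definition hexagon :: "real \<Rightarrow> (real^2) set" where
  "hexagon s = {q. \<bar>q$2\<bar> \<le> s \<and> \<bar>q$1\<bar> + s * \<bar>q$2\<bar> \<le> 1 + s\<^sup>2}"

section \<open>Support cones and the measure of their directions\<close>

lemma vector_2_eq_iff:
  "(vector [a, b] :: real^2) = vector [c, d] \<longleftrightarrow> a = c \<and> b = d"
  by (metis vector_2)

lemma inner_vector_2: "(vector [a, b] :: real^2) \<bullet> q = a * q$1 + b * q$2"
  by (simp add: inner_vec_def sum_2)

text \<open>A ray from \<open>p\<close> through a point of \<open>K\<close> stays in the halfplane
  because \<open>t\<close> is nonnegative, and a closed halfplane survives the closure.\<close>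

lemma support_cone_subset_halfspace:
  assumes "\<And>q. q \<in> K \<Longrightarrow> c \<bullet> q \<le> c \<bullet> p"
  shows "support_cone K p \<subseteq> {q. c \<bullet> q \<le> c \<bullet> p}"
  unfolding support_cone_def
proof (rule closure_minimal)
  show "{p + t *\<^sub>R (q - p) |q t. q \<in> K \<and> 0 \<le> t} \<subseteq> {q. c \<bullet> q \<le> c \<bullet> p}"
    using assms by (auto simp: inner_add_right inner_diff_right mult_nonneg_nonpos)
qed (rule closed_halfspace_le)

text \<open>Each supporting line at \<open>p\<close> thus becomes a linear condition on
  \<open>cos \<theta>\<close> and \<open>sin \<theta>\<close>. Such outer estimates of the cone
  suffice, since only upper bounds on angles are wanted.\<close>

lemma direction_in_support_cone:
  assumes "\<And>q. q \<in> K \<Longrightarrow> a * q$1 + b * q$2 \<le> a * p$1 + b * p$2"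
    and "p + vector [cos \<theta>, sin \<theta>] \<in> support_cone K p"
  shows "a * cos \<theta> + b * sin \<theta> \<le> 0"
proof -
  have "support_cone K p \<subseteq> {q. vector [a, b] \<bullet> q \<le> vector [a, b] \<bullet> p}"
    using assms(1) by (intro support_cone_subset_halfspace) (simp add: inner_vector_2)
  with assms(2) show ?thesis
    by (auto simp: inner_vector_2 algebra_simps)
qed

text \<open>The extra point \<open>c\<close> costs no measure. It is there because the circle of
  directions is cut at 0: a cone may give an interval ending at \<open>2 * pi\<close> together with
  the isolated angle 0.\<close>

lemma measure_lborel_le_interval:
  fixes a b c :: real
  assumes "S \<subseteq> insert c {a..b}" "a \<le> b"
  shows "measure lborel S \<le> b - a"
proof (cases "S \<in> sets lborel")
  case True
  have "insert c {a..b} \<in> fmeasurable lborel"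
    by (intro fmeasurableI emeasure_bounded_finite) auto
  then have "measure lborel S \<le> measure lborel ({c} \<union> {a..b})"
    using assms True by (intro measure_mono_fmeasurable) auto
  also have "\<dots> \<le> measure lborel {c} + measure lborel {a..b}"
    by (rule measure_Un_le) auto
  finally show ?thesis using assms by simp
next
  case False
  \<comment> \<open>By convention \<open>measure\<close> is 0 on a nonmeasurable set, so the bound
    reduces to \<open>a \<le> b\<close>.\<close>
  then show ?thesis using assms by (simp add: measure_notin_sets)
qed

lemma body_angle_le:
  assumes "\<And>\<theta>. 0 \<le> \<theta> \<Longrightarrow> \<theta> < 2 * pi \<Longrightarrow> p + vector [cos \<theta>, sin \<theta>] \<in> support_cone K p \<Longrightarrow>
      \<theta> = c \<or> a \<le> \<theta> \<and> \<theta> \<le> b"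
    and "a \<le> b"
  shows "body_angle K p \<le> b - a"
  unfolding body_angle_def angular_measure_def
proof (rule measure_lborel_le_interval[where c = c])
  show "{\<theta> \<in> {0..<2 * pi}. p + vector [cos \<theta>, sin \<theta>] \<in> support_cone K p} \<subseteq> insert c {a..b}"
    using assms(1) by fastforce
qed (rule assms(2))

section \<open>Signs of sine and cosine over one turn\<close>

lemma sin_nonpos_imp:
  assumes "0 \<le> \<theta>" "\<theta> < 2 * pi" "sin \<theta> \<le> 0"
  shows "\<theta> = 0 \<or> pi \<le> \<theta>"
  using assms sin_gt_zero[of \<theta>] by linarith

lemma sin_nonneg_imp:
  assumes "0 \<le> \<theta>" "\<theta> < 2 * pi" "0 \<le> sin \<theta>"
  shows "\<theta> \<le> pi"
  using assms sin_lt_zero[of \<theta>] by linarith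

lemma cos_pos_3pi_half:
  assumes "3 * pi / 2 < x" "x < 5 * pi / 2"
  shows "0 < cos x"
  using cos_gt_zero_pi[of "x - 2 * pi"] assms by (simp add: cos_diff)

lemma cos_neg_middle:
  assumes "pi / 2 < x" "x < 3 * pi / 2"
  shows "cos x < 0"
  using cos_gt_zero_pi[of "x - pi"] assms by (simp add: cos_diff)

text \<open>Up to the positive factor \<open>1 / sqrt (1 + s\<^sup>2)\<close>, the linear form is a
  cosine shifted by \<open>arctan s\<close>, the tilt of a slanted side against the
  vertical.\<close>

lemma cos_arctan_add:
  "cos (\<theta> + arctan s) \<le> 0 \<longleftrightarrow> cos \<theta> - s * sin \<theta> \<le> 0"
  "0 \<le> cos (\<theta> + arctan s) \<longleftrightarrow> 0 \<le> cos \<theta> - s * sin \<theta>"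
proof -
  have "cos (\<theta> + arctan s) = (cos \<theta> - s * sin \<theta>) / sqrt (1 + s\<^sup>2)"
    by (simp add: cos_add cos_arctan sin_arctan diff_divide_distrib)
  moreover have "0 < sqrt (1 + s\<^sup>2)"
    by (simp add: add_pos_nonneg)
  ultimately show "cos (\<theta> + arctan s) \<le> 0 \<longleftrightarrow> cos \<theta> - s * sin \<theta> \<le> 0"
    "0 \<le> cos (\<theta> + arctan s) \<longleftrightarrow> 0 \<le> cos \<theta> - s * sin \<theta>"
    by (simp_all add: divide_le_0_iff zero_le_divide_iff)
qed

section \<open>Angles of the hexagon on its long sides\<close>

text \<open>One linear inequality for each of the six sides, the form in which they serve as
  supporting halfplanes.\<close>

lemma hexagon_iff:
  assumes "0 < s"
  shows "q \<in> hexagon s \<longleftrightarrow> q$2 \<le> s \<and> - q$2 \<le> s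
    \<and> q$1 + s * q$2 \<le> 1 + s\<^sup>2 \<and> q$1 - s * q$2 \<le> 1 + s\<^sup>2
    \<and> - q$1 + s * q$2 \<le> 1 + s\<^sup>2 \<and> - q$1 - s * q$2 \<le> 1 + s\<^sup>2"
proof -
  have "s * \<bar>q$2\<bar> = \<bar>s * q$2\<bar>"
    using assms by (simp add: abs_mult)
  then show ?thesis
    unfolding hexagon_def mem_Collect_eq by linarith
qed

text \<open>Each conclusion comes from a side whose line passes through \<open>p\<close>; for the
  slanted sides this is \<open>1 + s * s = 1 + s\<^sup>2\<close> at the corner.\<close>

lemma hexagon_direction:
  assumes "0 < s" "p + vector [cos \<theta>, sin \<theta>] \<in> support_cone (hexagon s) p"
  shows "p$2 = s \<Longrightarrow> sin \<theta> \<le> 0"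
    and "p$2 = - s \<Longrightarrow> 0 \<le> sin \<theta>"
    and "p = vector [1, s] \<Longrightarrow> cos \<theta> + s * sin \<theta> \<le> 0"
    and "p = vector [1, - s] \<Longrightarrow> cos \<theta> - s * sin \<theta> \<le> 0"
    and "p = vector [-1, s] \<Longrightarrow> 0 \<le> cos \<theta> - s * sin \<theta>"
    and "p = vector [-1, - s] \<Longrightarrow> 0 \<le> cos \<theta> + s * sin \<theta>"
proof -
  note dir = direction_in_support_cone[OF _ assms(2)]
  note half = hexagon_iff[OF assms(1)]
  show "sin \<theta> \<le> 0" if "p$2 = s"
    using dir[of 0 1] that by (simp add: half)
  show "0 \<le> sin \<theta>" if "p$2 = - s"
    using dir[of 0 "-1"] that by (simp add: half)
  show "cos \<theta> + s * sin \<theta> \<le> 0" if "p = vector [1, s]"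
    using dir[of 1 s] that by (simp add: half power2_eq_square)
  show "cos \<theta> - s * sin \<theta> \<le> 0" if "p = vector [1, - s]"
    using dir[of 1 "- s"] that by (simp add: half power2_eq_square)
  show "0 \<le> cos \<theta> - s * sin \<theta>" if "p = vector [-1, s]"
    using dir[of "-1" s] that by (simp add: half power2_eq_square)
  show "0 \<le> cos \<theta> + s * sin \<theta>" if "p = vector [-1, - s]"
    using dir[of "-1" "- s"] that by (simp add: half power2_eq_square)
qed

lemma hexagon_top_angle:
  assumes "0 < s" "p$2 = s"
  shows "body_angle (hexagon s) p \<le> pi"
proof -
  have "body_angle (hexagon s) p \<le> 2 * pi - pi"
    using hexagon_direction(1)[OF assms(1) _ assms(2)] sin_nonpos_imp
    by (intro body_angle_le[where c = 0]) fastforce+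
  then show ?thesis by simp
qed

text \<open>The horizontal and the slanted side meeting at the corner confine the directions: the
  first leaves a half turn, the second cuts it down to a quarter turn plus its tilt
  \<open>\<alpha>\<close>.\<close>

lemma hexagon_corner_angle:
  assumes s: "0 < s" and e: "e = 1 \<or> e = -1" and y: "y = s \<or> y = - s"
  shows "body_angle (hexagon s) (vector [e, y]) \<le> pi / 2 + arctan s"
proof -
  let ?p = "vector [e, y] :: real^2"
  define \<alpha> where "\<alpha> = arctan s"
  have \<alpha>: "0 < \<alpha>" "\<alpha> < pi / 2"
    using s arctan_ubound[of s] by (auto simp: \<alpha>_def)
  note dir = hexagon_direction[OF s, of ?p]
  note add = cos_arctan_add[of _ s, folded \<alpha>_def]
  \<comment> \<open>Replacing \<open>s\<close> by \<open>- s\<close> turns the shift by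
    \<open>\<alpha>\<close> into one by \<open>- \<alpha>\<close>.\<close>
  note sub = cos_arctan_add[of _ "- s", unfolded arctan_minus, folded \<alpha>_def, simplified]
  consider "?p = vector [1, s]" | "?p = vector [1, - s]"
    | "?p = vector [-1, s]" | "?p = vector [-1, - s]"
    using e y by auto
  then show ?thesis
  proof cases
    case 1
    have "body_angle (hexagon s) ?p \<le> (3 * pi / 2 + \<alpha>) - pi"
    proof (rule body_angle_le[where c = 0])
      fix \<theta> assume \<theta>: "0 \<le> \<theta>" "\<theta> < 2 * pi"
        and *: "?p + vector [cos \<theta>, sin \<theta>] \<in> support_cone (hexagon s) ?p"
      have "sin \<theta> \<le> 0" "cos (\<theta> - \<alpha>) \<le> 0"
        using dir(1,3)[OF *] 1 by (simp_all add: sub)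
      then show "\<theta> = 0 \<or> pi \<le> \<theta> \<and> \<theta> \<le> 3 * pi / 2 + \<alpha>"
        using sin_nonpos_imp[OF \<theta>] cos_pos_3pi_half[of "\<theta> - \<alpha>"] \<theta> \<alpha> by linarith
    qed (use \<alpha> in simp)
    then show ?thesis by (simp add: \<alpha>_def)
  next
    case 2
    have "body_angle (hexagon s) ?p \<le> pi - (pi / 2 - \<alpha>)"
    proof (rule body_angle_le[where c = 0])
      fix \<theta> assume \<theta>: "0 \<le> \<theta>" "\<theta> < 2 * pi"
        and *: "?p + vector [cos \<theta>, sin \<theta>] \<in> support_cone (hexagon s) ?p"
      have "0 \<le> sin \<theta>" "cos (\<theta> + \<alpha>) \<le> 0"
        using dir(2,4)[OF *] 2 by (simp_all add: add)
      then show "\<theta> = 0 \<or> pi / 2 - \<alpha> \<le> \<theta> \<and> \<theta> \<le> pi"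
        using sin_nonneg_imp[OF \<theta>] cos_gt_zero_pi[of "\<theta> + \<alpha>"] \<theta> \<alpha> by linarith
    qed (use \<alpha> in simp)
    then show ?thesis by (simp add: \<alpha>_def)
  next
    case 3
    \<comment> \<open>Here the top side itself has direction 0, cut off from the other directions
      just below \<open>2 * pi\<close>; the exceptional point absorbs it.\<close>
    have "body_angle (hexagon s) ?p \<le> 2 * pi - (3 * pi / 2 - \<alpha>)"
    proof (rule body_angle_le[where c = 0])
      fix \<theta> assume \<theta>: "0 \<le> \<theta>" "\<theta> < 2 * pi"
        and *: "?p + vector [cos \<theta>, sin \<theta>] \<in> support_cone (hexagon s) ?p"
      have "sin \<theta> \<le> 0" "0 \<le> cos (\<theta> + \<alpha>)"
        using dir(1,5)[OF *] 3 by (simp_all add: add)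
      then show "\<theta> = 0 \<or> 3 * pi / 2 - \<alpha> \<le> \<theta> \<and> \<theta> \<le> 2 * pi"
        using sin_nonpos_imp[OF \<theta>] cos_neg_middle[of "\<theta> + \<alpha>"] \<theta> \<alpha> by linarith
    qed (use \<alpha> in simp)
    then show ?thesis by (simp add: \<alpha>_def)
  next
    case 4
    have "body_angle (hexagon s) ?p \<le> (pi / 2 + \<alpha>) - 0"
    proof (rule body_angle_le[where c = 0])
      fix \<theta> assume \<theta>: "0 \<le> \<theta>" "\<theta> < 2 * pi"
        and *: "?p + vector [cos \<theta>, sin \<theta>] \<in> support_cone (hexagon s) ?p"
      have "0 \<le> sin \<theta>" "0 \<le> cos (\<theta> - \<alpha>)"
        using dir(2,6)[OF *] 4 by (simp_all add: sub)
      then show "\<theta> = 0 \<or> 0 \<le> \<theta> \<and> \<theta> \<le> pi / 2 + \<alpha>"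
        using sin_nonneg_imp[OF \<theta>] cos_neg_middle[of "\<theta> - \<alpha>"] \<theta> \<alpha> by linarith
    qed (use \<alpha> in simp)
    then show ?thesis by (simp add: \<alpha>_def)
  qed
qed

section \<open>The hexagon as a convex body and its boundary\<close>

lemma planar_convex_body_hexagon:
  assumes "0 < s"
  shows "planar_convex_body (hexagon s)"
proof -
  have "closed (hexagon s)"
    unfolding hexagon_def by (intro closed_Collect_conj closed_Collect_le continuous_intros)
  moreover have "bounded (hexagon s)"
  proof -
    have "norm q \<le> (1 + s\<^sup>2) + s" if "q \<in> hexagon s" for q
    proof -
      have "norm q \<le> \<bar>q$1\<bar> + \<bar>q$2\<bar>"
        using norm_le_l1_cart[of q] by (simp add: sum_2)
      moreover have "0 \<le> s * \<bar>q$2\<bar>" using assms by simp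
      ultimately show ?thesis using that unfolding hexagon_def by auto
    qed
    then show ?thesis unfolding bounded_iff by blast
  qed
  moreover have "convex (hexagon s)"
  proof -
    have "hexagon s = {q. vector [0, 1] \<bullet> q \<le> s} \<inter> {q. vector [0, -1] \<bullet> q \<le> s}
      \<inter> {q. vector [1, s] \<bullet> q \<le> 1 + s\<^sup>2} \<inter> {q. vector [1, - s] \<bullet> q \<le> 1 + s\<^sup>2}
      \<inter> {q. vector [-1, s] \<bullet> q \<le> 1 + s\<^sup>2} \<inter> {q. vector [-1, - s] \<bullet> q \<le> 1 + s\<^sup>2}"
      by (auto simp: hexagon_iff[OF assms] inner_vector_2)
    then show ?thesis
      by (auto intro!: convex_Int convex_halfspace_le)
  qed
  moreover have "0 \<in> interior (hexagon s)"
  proof (rule interiorI)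
    let ?U = "{q :: real^2. \<bar>q$2\<bar> < s \<and> \<bar>q$1\<bar> + s * \<bar>q$2\<bar> < 1 + s\<^sup>2}"
    show "open ?U"
      by (intro open_Collect_conj open_Collect_less continuous_intros)
    show "0 \<in> ?U" using assms by (simp add: add_pos_nonneg)
    show "?U \<subseteq> hexagon s" unfolding hexagon_def by auto
  qed
  ultimately show ?thesis
    unfolding planar_convex_body_def by (auto simp: compact_eq_bounded_closed)
qed

lemma long_side_subset_hexagon:
  assumes "0 < s" "\<bar>t\<bar> \<le> 1" "\<bar>y\<bar> = s"
  shows "vector [t, y] \<in> hexagon s"
  using assms unfolding hexagon_def by (simp add: power2_eq_square)

text \<open>The interior lies in the interiors of the two halfplanes bounded by the long sides,
  which are open and miss these sides.\<close>

lemma long_side_subset_frontier: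
  assumes "0 < s" "\<bar>t\<bar> \<le> 1" "\<bar>y\<bar> = s"
  shows "vector [t, y] \<in> frontier (hexagon s)"
proof -
  have "q$2 \<noteq> s \<and> q$2 \<noteq> - s" if "q \<in> interior (hexagon s)" for q
  proof -
    have "interior (hexagon s) \<subseteq> interior {q. q$2 \<le> s}"
      "interior (hexagon s) \<subseteq> interior {q. q$2 \<ge> - s}"
      by (intro interior_mono; auto simp: hexagon_def)+
    then show ?thesis
      using that by auto
  qed
  then have "vector [t, y] \<notin> interior (hexagon s)"
    using assms by (metis vector_2(2) abs_eq_iff abs_of_pos)
  then show ?thesis
    using long_side_subset_hexagon[OF assms] closure_subset unfolding frontier_def by blast
qed

section \<open>Diametral points\<close>

lemma dist_vector_2_sq:
  "(dist p (q :: real^2))\<^sup>2 = (p$1 - q$1)\<^sup>2 + (p$2 - q$2)\<^sup>2"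
  by (simp add: dist_vec_def L2_set_def sum_2 dist_real_def)

text \<open>The other end \<open>q\<close> of a diameter would be at least as far away as the two
  apices are from each other. But a height \<open>w\<close> of \<open>q\<close> off the horizontal
  axis costs \<open>s * w\<close> in horizontal reach, which keeps the distance smaller.\<close>

lemma long_side_not_diametral:
  assumes "0 < s" "\<bar>t\<bar> \<le> 1" "\<bar>y\<bar> = s"
  shows "\<not> diametral_point (hexagon s) (vector [t, y])"
proof
  assume "diametral_point (hexagon s) (vector [t, y])"
  then obtain q where q: "q \<in> hexagon s"
    and dq: "dist (vector [t, y]) q = diameter (hexagon s)"
    unfolding diametral_point_def is_diameter_def by auto
  let ?a = "vector [1 + s\<^sup>2, 0] :: real^2" and ?b = "vector [- (1 + s\<^sup>2), 0] :: real^2"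
  have "bounded (hexagon s)"
    using planar_convex_body_hexagon[OF assms(1)]
    by (simp add: planar_convex_body_def compact_imp_bounded)
  moreover have "?a \<in> hexagon s" "?b \<in> hexagon s"
    using assms(1) by (auto simp: hexagon_iff)
  ultimately have "dist ?a ?b \<le> dist (vector [t, y]) q"
    unfolding dq by (rule diameter_bounded_bound)
  then have "(dist ?a ?b)\<^sup>2 \<le> (dist (vector [t, y]) q)\<^sup>2"
    by (simp add: power_mono)
  then have le: "(2 * (1 + s\<^sup>2))\<^sup>2 \<le> (t - q$1)\<^sup>2 + (y - q$2)\<^sup>2"
    by (simp add: dist_vector_2_sq algebra_simps)
  define w where "w = \<bar>q$2\<bar>"
  have w: "0 \<le> w" "w \<le> s" "\<bar>q$1\<bar> \<le> 1 + s\<^sup>2 - s * w"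
    using q unfolding hexagon_def w_def by auto
  have "(t - q$1)\<^sup>2 \<le> (2 + s\<^sup>2 - s * w)\<^sup>2"
    using w(3) assms(2) by (intro abs_le_square_iff[THEN iffD1]) linarith
  moreover have "(y - q$2)\<^sup>2 \<le> (s + w)\<^sup>2"
    using assms(3) by (intro abs_le_square_iff[THEN iffD1]) (simp add: w_def)
  \<comment> \<open>Right minus left is \<open>3 * s^2 + 3 * s^4 + (2 * s * w - w^2) + s^2 * (2 * s
    * w - w^2)\<close>, and \<open>w^2 \<le> s * w\<close> makes both brackets nonnegative.\<close>
  moreover have "(2 + s\<^sup>2 - s * w)\<^sup>2 + (s + w)\<^sup>2 < (2 * (1 + s\<^sup>2))\<^sup>2"
  proof -
    have "w * w \<le> s * w" using w by (simp add: mult_right_mono)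
    moreover from this have "s\<^sup>2 * (w * w) \<le> s\<^sup>2 * (s * w)"
      by (intro mult_left_mono) auto
    moreover have "0 \<le> s * w" "0 < s\<^sup>2" "0 < s\<^sup>2 * s\<^sup>2" "0 \<le> s\<^sup>2 * (s * w)"
      using assms(1) w by auto
    ultimately show ?thesis
      by (simp add: power2_eq_square algebra_simps)
  qed
  ultimately show False using le by linarith
qed

section \<open>The configuration of points\<close>

lemma ex_small_angle_sum_not_diametral:
  assumes "n \<ge> 4" "0 < s"
  obtains K :: "(real^2) set" and x :: "nat \<Rightarrow> real^2"
  where "planar_convex_body K" "inj_on x {1..n}" "\<forall>i\<in>{1..n}. x i \<in> frontier K"
    "(\<Sum>i=1..n. body_angle K (x i)) \<le> (real n - 2) * pi + 4 * s"
    "\<forall>i\<in>{1..n}. \<not> diametral_point K (x i)"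
proof -
  note s = assms(2)
  \<comment> \<open>Indices 1 to 4 give the rectangle vertices; each \<open>i \<ge> 5\<close> gives
    the point \<open>(1 / i, s)\<close>, strictly between the two top vertices and distinct for
    distinct \<open>i\<close>.\<close>
  define t :: "nat \<Rightarrow> real" where
    "t i = (if i \<in> {1, 3} then 1 else if i \<in> {2, 4} then -1 else 1 / real i)" for i
  define y where "y i = (if i \<in> {3, 4} then - s else s)" for i :: nat
  define x :: "nat \<Rightarrow> real^2" where "x i = vector [t i, y i]" for i
  have t: "\<bar>t i\<bar> \<le> 1" if "i \<in> {1..n}" for i
    using that by (auto simp: t_def)
  have y: "\<bar>y i\<bar> = s" for i
    using s by (auto simp: y_def)
  have "inj_on x {1..n}"
  proof (rule inj_onI)
    fix i j assume ij: "i \<in> {1..n}" "j \<in> {1..n}" "x i = x j"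
    then have "t i = t j" "y i = y j"
      by (simp_all add: x_def vector_2_eq_iff)
    then show "i = j"
      using s ij(1,2) by (auto simp: t_def y_def field_simps split: if_splits)
  qed
  moreover have "\<forall>i\<in>{1..n}. x i \<in> frontier (hexagon s)"
    using long_side_subset_frontier[OF s t y] by (simp add: x_def)
  moreover have "(\<Sum>i=1..n. body_angle (hexagon s) (x i)) \<le> (real n - 2) * pi + 4 * s"
  proof -
    have "(\<Sum>i=1..n. body_angle (hexagon s) (x i))
      = (\<Sum>i=1..4. body_angle (hexagon s) (x i)) + (\<Sum>i=5..n. body_angle (hexagon s) (x i))"
      \<comment> \<open>For \<open>n = 4\<close> the second sum is empty.\<close>
      using sum.ub_add_nat[of 1 4 "\<lambda>i. body_angle (hexagon s) (x i)" "n - 4"] assms by simp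
    also have "(\<Sum>i=1..4. body_angle (hexagon s) (x i)) \<le> (\<Sum>i::nat=1..4. pi / 2 + arctan s)"
    proof (rule sum_mono)
      fix i :: nat assume "i \<in> {1..4}"
      then have "t i = 1 \<or> t i = -1" "y i = s \<or> y i = - s"
        by (auto simp: t_def y_def)
      then show "body_angle (hexagon s) (x i) \<le> pi / 2 + arctan s"
        unfolding x_def by (rule hexagon_corner_angle[OF s])
    qed
    also have "(\<Sum>i=5..n. body_angle (hexagon s) (x i)) \<le> (\<Sum>i=5..n. pi)"
      by (intro sum_mono hexagon_top_angle[OF s]) (auto simp: x_def y_def)
    finally have "(\<Sum>i=1..n. body_angle (hexagon s) (x i))
      \<le> 4 * (pi / 2 + arctan s) + (real n - 4) * pi"
      using assms by (simp add: of_nat_diff)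
    \<comment> \<open>Passing from \<open>arctan s\<close> to \<open>s\<close> makes the excess
      linear, so that \<open>s\<close> can be solved for.\<close>
    also have "\<dots> \<le> 4 * (pi / 2 + s) + (real n - 4) * pi"
      using arctan_le_self[of s] s by simp
    also have "\<dots> = (real n - 2) * pi + 4 * s"
      by (simp add: field_simps)
    finally show ?thesis by simp
  qed
  moreover have "\<forall>i\<in>{1..n}. \<not> diametral_point (hexagon s) (x i)"
    using long_side_not_diametral[OF s t y] by (simp add: x_def)
  ultimately show thesis
    using that[OF planar_convex_body_hexagon[OF s]] by blast
qed

theorem mainTheorem4:
  fixes n :: nat
  assumes "n \<ge> 4"
  shows "\<not> (\<exists>d::real. d > (real n - 2) * pi \<and>
    (\<forall>(K::(real^2) set) (x::nat \<Rightarrow> real^2).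
       planar_convex_body K \<and> inj_on x {1..n} \<and> (\<forall>i\<in>{1..n}. x i \<in> frontier K) \<and>
       (\<Sum>i=1..n. body_angle K (x i)) \<le> d
       \<longrightarrow> (\<exists>i\<in>{1..n}. diametral_point K (x i))))"
proof (intro notI, elim exE conjE)
  fix d :: real
  assume d: "d > (real n - 2) * pi"
    and all: "\<forall>(K::(real^2) set) (x::nat \<Rightarrow> real^2).
       planar_convex_body K \<and> inj_on x {1..n} \<and> (\<forall>i\<in>{1..n}. x i \<in> frontier K) \<and>
       (\<Sum>i=1..n. body_angle K (x i)) \<le> d
       \<longrightarrow> (\<exists>i\<in>{1..n}. diametral_point K (x i))"
  \<comment> \<open>With this choice the bound \<open>(real n - 2) * pi + 4 * s\<close> is exactly
    \<open>d\<close>.\<close>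
  define s where "s = (d - (real n - 2) * pi) / 4"
  have s: "0 < s" "(real n - 2) * pi + 4 * s = d"
    using d by (simp_all add: s_def field_simps)
  show False
    using ex_small_angle_sum_not_diametral[OF assms s(1)] all unfolding s(2) by metis
qed

end
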